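(* Let $a_0<b_0$ be real numbers and let $S\subset[a_0,b_0]$ be the target set for the Cantor game on $[a_0,b_0]$. If $S$ is a Bernstein set in $[a_0,b_0]$, then neither player A nor player B has a winning strategy.
   Context: Base theory: ZFC. For $X\subset\mathbb{R}$ with the subspace topology, a Bernstein set in $X$ is a set $S\subset X$ such that neither $S$ nor $X-S$ contains an uncountable closed set (closed in $X$). Cantor game on $[a_0,b_0]$ with target set $S\subset[a_0,b_0]$: $a_0<b_0$ are fixed reals. At turn $n\ge1$ player A chooses a real $a_n$ with $a_{n-1}<a_n<b_{n-1}$, then player B chooses a real $b_n$ with $a_n<b_n<b_{n-1}$. Player A wins if $\lim_{n\to\infty}a_n\in S$; otherwise player B wins. A play is a pair of sequences $((a_n)_{n\ge0},(b_n)_{n\ge0})$, starting with the fixed $a_0,b_0$, with $a_{n-1}<a_n<b_n<b_{n-1}$ for all $n\ge1$. A strategy for player A is a sequence of real-valued functions $(f_n)_{n\ge0}$, where for $n\ge1$ the function $f_{n-1}$ is defined on all tuples $(a_0,b_0,a_1,b_1,\dots,a_{n-1},b_{n-1})$ (with $a_0,b_0$ the fixed values) satisfying $a_0<a_1<\dots<a_{n-1}<b_{n-1}<\dots<b_1<b_0$, and $a_{n-1}<f_{n-1}(a_0,b_0,\dots,a_{n-1},b_{n-1})<b_{n-1}$. A strategy for player B is a sequence of real-valued functions $(g_n)_{n\ge0}$, where for $n\ge1$ the function $g_{n-1}$ is defined on all tuples $(a_0,b_0,a_1,b_1,\dots,a_{n-1},b_{n-1},a_n)$ satisfying $a_0<a_1<\dots<a_n<b_{n-1}<\dots<b_1<b_0$,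 and $a_n<g_{n-1}(a_0,b_0,\dots,a_{n-1},b_{n-1},a_n)<b_{n-1}$. A play is consistent with $(f_n)$ if $a_n=f_{n-1}(a_0,b_0,\dots,a_{n-1},b_{n-1})$ for all $n\ge1$, and consistent with $(g_n)$ if $b_n=g_{n-1}(a_0,b_0,\dots,a_{n-1},b_{n-1},a_n)$ for all $n\ge1$. The limit set $L(\cdot)$ of a strategy is the set of all $\lim_{n\to\infty}a_n$ over plays consistent with it. $(f_n)$ is winning for player A if $L((f_n))\subset S$; $(g_n)$ is winning for player B if $L((g_n))\subset[a_0,b_0]-S$. *)

theory Defs
  imports "HOL-Analysis.Analysis"
begin

definition bernstein_set_in :: "real set \<Rightarrow> real set \<Rightarrow> bool" where
  "bernstein_set_in X S \<longleftrightarrow>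
     S \<subseteq> X \<and>
     (\<forall>C. closedin (top_of_set X) C \<and> uncountable C \<longrightarrow> \<not> C \<subseteq> S \<and> \<not> C \<subseteq> X - S)"

(* The tuple (a_0, b_0, ..., a_n, b_n) is encoded as the list [(a_0, b_0), ..., (a_n, b_n)].
   cantor_positions a0 b0 n is the domain of f_n: the tuples with first pair (a0, b0) and
   a_0 < ... < a_n < b_n < ... < b_0. *)
definition cantor_positions :: "real \<Rightarrow> real \<Rightarrow> nat \<Rightarrow> (real \<times> real) list set" where
  "cantor_positions a0 b0 n =
     {p. length p = Suc n \<and> p ! 0 = (a0, b0) \<and>
         (\<forall>i<n. fst (p ! i) < fst (p ! Suc i) \<and> snd (p ! Suc i) < snd (p ! i)) \<and>
         fst (p ! n) < snd (p ! n)}"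

definition cantor_history :: "(nat \<Rightarrow> real) \<Rightarrow> (nat \<Rightarrow> real) \<Rightarrow> nat \<Rightarrow> (real \<times> real) list" where
  "cantor_history a b n = map (\<lambda>i. (a i, b i)) [0..<Suc n]"

definition cantor_play :: "real \<Rightarrow> real \<Rightarrow> (nat \<Rightarrow> real) \<Rightarrow> (nat \<Rightarrow> real) \<Rightarrow> bool" where
  "cantor_play a0 b0 a b \<longleftrightarrow>
     a 0 = a0 \<and> b 0 = b0 \<and>
     (\<forall>n. a n < a (Suc n) \<and> a (Suc n) < b (Suc n) \<and> b (Suc n) < b n)"

(* Strategies are total functions here; only their values on legal positions (and, for B,
   legal moves x = a_(n+1) of A) are constrained, and only those values are ever used by plays. *)
definition strategy_A ::
  "real \<Rightarrow> real \<Rightarrow> (nat \<Rightarrow> (real \<times> real) list \<Rightarrow> real) \<Rightarrow> bool" where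
  "strategy_A a0 b0 f \<longleftrightarrow>
     (\<forall>n. \<forall>p \<in> cantor_positions a0 b0 n. fst (p ! n) < f n p \<and> f n p < snd (p ! n))"

definition strategy_B ::
  "real \<Rightarrow> real \<Rightarrow> (nat \<Rightarrow> (real \<times> real) list \<Rightarrow> real \<Rightarrow> real) \<Rightarrow> bool" where
  "strategy_B a0 b0 g \<longleftrightarrow>
     (\<forall>n. \<forall>p \<in> cantor_positions a0 b0 n. \<forall>x. fst (p ! n) < x \<and> x < snd (p ! n) \<longrightarrow>
        x < g n p x \<and> g n p x < snd (p ! n))"

definition consistent_A ::
  "(nat \<Rightarrow> (real \<times> real) list \<Rightarrow> real) \<Rightarrow> (nat \<Rightarrow> real) \<Rightarrow> (nat \<Rightarrow> real) \<Rightarrow> bool" where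
  "consistent_A f a b \<longleftrightarrow> (\<forall>n. a (Suc n) = f n (cantor_history a b n))"

definition consistent_B ::
  "(nat \<Rightarrow> (real \<times> real) list \<Rightarrow> real \<Rightarrow> real) \<Rightarrow> (nat \<Rightarrow> real) \<Rightarrow> (nat \<Rightarrow> real) \<Rightarrow> bool" where
  "consistent_B g a b \<longleftrightarrow> (\<forall>n. b (Suc n) = g n (cantor_history a b n) (a (Suc n)))"

definition limit_set_A ::
  "real \<Rightarrow> real \<Rightarrow> (nat \<Rightarrow> (real \<times> real) list \<Rightarrow> real) \<Rightarrow> real set" where
  "limit_set_A a0 b0 f =
     {l. \<exists>a b. cantor_play a0 b0 a b \<and> consistent_A f a b \<and> a \<longlonglongrightarrow> l}"

definition limit_set_B ::
  "real \<Rightarrow> real \<Rightarrow> (nat \<Rightarrow> (real \<times> real) list \<Rightarrow> real \<Rightarrow> real) \<Rightarrow> real set" where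
  "limit_set_B a0 b0 g =
     {l. \<exists>a b. cantor_play a0 b0 a b \<and> consistent_B g a b \<and> a \<longlonglongrightarrow> l}"

definition winning_strategy_A ::
  "real \<Rightarrow> real \<Rightarrow> real set \<Rightarrow> (nat \<Rightarrow> (real \<times> real) list \<Rightarrow> real) \<Rightarrow> bool" where
  "winning_strategy_A a0 b0 S f \<longleftrightarrow> strategy_A a0 b0 f \<and> limit_set_A a0 b0 f \<subseteq> S"

definition winning_strategy_B ::
  "real \<Rightarrow> real \<Rightarrow> real set \<Rightarrow> (nat \<Rightarrow> (real \<times> real) list \<Rightarrow> real \<Rightarrow> real) \<Rightarrow> bool" where
  "winning_strategy_B a0 b0 S g \<longleftrightarrow> strategy_B a0 b0 g \<and> limit_set_B a0 b0 g \<subseteq> {a0..b0} - S"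

end

theory Submission
  imports Defs
begin

text \<open>
  Against a fixed strategy, the opponent can at every position choose between two moves that
  force the limit into disjoint compact intervals of length at most \<open>1 / (n + 1)\<close>. The binary tree
  of such choices is a Cantor scheme whose points are all limits of consistent plays, so the limit
  set contains an uncountable closed set. A Bernstein set neither contains nor misses such a set.
\<close>

section \<open>Binary branches and Cantor schemes\<close>

text \<open>The newest choice sits at the head, so prolonging a branch is \<open>Cons\<close> and
  the tree of choices can be treated by recursion on lists.\<close>

definition branch :: "(nat \<Rightarrow> 'a) \<Rightarrow> nat \<Rightarrow> 'a list" where
  "branch c n = rev (map c [0..<n])"

lemma branch_0 [simp]: "branch c 0 = []"
  and branch_Suc [simp]: "branch c (Suc n) = c n # branch c n"
  and length_branch [simp]: "length (branch c n) = n"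
  by (simp_all add: branch_def)

lemma branch_eq_imp_eq:
  assumes "\<And>n. branch c n = branch d n"
  shows "c = d"
proof
  fix n
  show "c n = d n" using assms[of "Suc n"] by simp
qed

lemma uncountable_UNIV_nat_bool: "uncountable (UNIV :: (nat \<Rightarrow> bool) set)"
proof
  assume "countable (UNIV :: (nat \<Rightarrow> bool) set)"
  then obtain e :: "nat \<Rightarrow> nat \<Rightarrow> bool" where e: "range e = UNIV"
    using range_from_nat_into[of "UNIV :: (nat \<Rightarrow> bool) set"] by blast
  then obtain k where "e k = (\<lambda>n. \<not> e n n)" by (metis surjD)
  then show False by (metis (full_types))
qed

text \<open>Compactness gives every infinite branch a point, and disjointness gives different
  branches different points, so there are at least as many points as 0-1 sequences. Each level has
  finitely many nodes, which makes the set closed.\<close>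

lemma cantor_scheme:
  fixes I :: "bool list \<Rightarrow> 'a :: heine_borel set"
  assumes compact: "\<And>s. compact (I s)"
    and nonempty: "\<And>s. I s \<noteq> {}"
    and nested: "\<And>c s. I (c # s) \<subseteq> I s"
    and disjoint: "\<And>s. I (True # s) \<inter> I (False # s) = {}"
  obtains K where "closed K" "uncountable K" "\<And>x. x \<in> K \<Longrightarrow> \<exists>c. \<forall>n. x \<in> I (branch c n)"
proof -
  \<comment> \<open>Disjointness of siblings spreads to whole levels: distinct nodes of one level
    either are siblings or have distinct tails, whose sets are disjoint by induction and contain
    theirs.\<close>
  have disj: "I s \<inter> I t = {}" if "length s = length t" "s \<noteq> t" for s t
    using that
  proof (induction s t rule: list_induct2)
    case (Cons c s d t)
    show ?case
    proof (cases "s = t")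
      case True
      then show ?thesis using Cons.prems disjoint[of s] by (cases c; cases d) auto
    next
      case False
      then show ?thesis using Cons.IH nested[of c s] nested[of d t] by blast
    qed
  qed simp
  \<comment> \<open>Intersecting the unions of the levels, rather than uniting over branches, makes
    closedness immediate; that each point of \<open>K\<close> follows a branch is shown at the
    end.\<close>
  define K where "K = (\<Inter>n. \<Union>s\<in>{s. length s = n}. I s)"
  have fin: "finite {s :: bool list. length s = n}" for n
    using finite_lists_length_eq[of "UNIV :: bool set" n] by simp
  have "closed K"
    unfolding K_def by (intro closed_INT closed_UN fin ballI compact_imp_closed compact)
  have "\<exists>x. \<forall>n. x \<in> I (branch c n)" for c
  proof -
    have "I (branch c n) \<subseteq> I (branch c m)" if "m \<le> n" for m n
      by (rule lift_Suc_antimono_le[OF _ that]) (simp add: nested)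
    then have "(\<Inter>n. I (branch c n)) \<noteq> {}"
      by (intro compact_nest compact nonempty)
    then show ?thesis by blast
  qed
  then obtain h where h: "\<And>c n. h c \<in> I (branch c n)" by metis
  have "inj h"
  proof (rule injI)
    fix c d assume eq: "h c = h d"
    have "branch c n = branch d n" for n
      using disj[of "branch c n" "branch d n"] h[of c n] h[of d n] eq by force
    then show "c = d" by (rule branch_eq_imp_eq)
  qed
  moreover have "range h \<subseteq> K"
    unfolding K_def using h length_branch by blast
  ultimately have "uncountable K"
    using uncountable_UNIV_nat_bool by (metis countable_image_inj_on countable_subset)
  have "\<exists>c. \<forall>n. x \<in> I (branch c n)" if "x \<in> K" for x
  proof -
    from that have "\<forall>n. \<exists>s. length s = n \<and> x \<in> I s" by (auto simp: K_def)
    then obtain t where t: "\<And>n. length (t n) = n" "\<And>n. x \<in> I (t n)" by metis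
    \<comment> \<open>By nesting, \<open>x\<close> also lies in the set of the tail of
      \<open>t (Suc n)\<close>, so by disjointness that tail is \<open>t n\<close>. Hence the nodes
      \<open>t n\<close> form one branch, with the heads as its choices.\<close>
    have "t (Suc n) = hd (t (Suc n)) # t n" for n
    proof -
      obtain c s where cs: "t (Suc n) = c # s" "length s = n"
        using t(1)[of "Suc n"] by (metis length_Suc_conv)
      have "x \<in> I s" using t(2)[of "Suc n"] cs nested by auto
      then have "s = t n" using disj[of s "t n"] t(1,2)[of n] cs(2) by fastforce
      then show ?thesis using cs by simp
    qed
    then have "t n = branch (\<lambda>n. hd (t (Suc n))) n" for n
      using t(1)[of 0] by (induction n) (simp, metis branch_Suc)
    then show ?thesis using t(2) by metis
  qed
  with \<open>closed K\<close> \<open>uncountable K\<close> show thesis by (rule that)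
qed

section \<open>Legal positions, convergence of plays and the tree of choices\<close>

lemma cantor_positions_0: "a0 < b0 \<Longrightarrow> [(a0, b0)] \<in> cantor_positions a0 b0 0"
  by (simp add: cantor_positions_def)

lemma cantor_positions_length: "p \<in> cantor_positions a0 b0 n \<Longrightarrow> length p = Suc n"
  by (simp add: cantor_positions_def)

lemma cantor_positions_less: "p \<in> cantor_positions a0 b0 n \<Longrightarrow> fst (p ! n) < snd (p ! n)"
  by (simp add: cantor_positions_def)

lemma cantor_positions_append:
  assumes "p \<in> cantor_positions a0 b0 n"
    and "fst (p ! n) < fst m" "fst m < snd m" "snd m < snd (p ! n)"
  shows "p @ [m] \<in> cantor_positions a0 b0 (Suc n)"
  using assms by (auto simp: cantor_positions_def nth_append less_Suc_eq)

lemma cantor_history_Suc: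
  "cantor_history a b (Suc n) = cantor_history a b n @ [(a (Suc n), b (Suc n))]"
  by (simp add: cantor_history_def)

text \<open>Squeeze between \<open>x - 1 / real (Suc n)\<close> and \<open>x\<close>. The sequence
  is shifted by one because the initial interval is given and need not be short.\<close>

lemma cantor_play_convergent:
  assumes bounds: "\<And>n. a n \<le> x" "\<And>n. x \<le> b n"
    and small: "\<And>n. b (Suc n) - a (Suc n) < 1 / real (Suc n)"
  shows "a \<longlonglongrightarrow> (x :: real)"
proof -
  have "(\<lambda>n. a (Suc n)) \<longlonglongrightarrow> x"
  proof (rule tendsto_sandwich[OF always_eventually always_eventually _ tendsto_const])
    show "\<forall>n. x - 1 / real (Suc n) \<le> a (Suc n)"
      using bounds(2) small by (metis add.commute diff_le_eq dual_order.trans less_eq_real_def)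
    show "\<forall>n. a (Suc n) \<le> x" using bounds(1) by blast
    have "(\<lambda>n. x - 1 / real (Suc n)) \<longlonglongrightarrow> x - 0"
      by (intro tendsto_intros LIMSEQ_Suc[OF lim_1_over_n])
    then show "(\<lambda>n. x - 1 / real (Suc n)) \<longlonglongrightarrow> x" by simp
  qed
  then show ?thesis by (rule LIMSEQ_imp_Suc)
qed

text \<open>
  \<open>M n p\<close> is the set of pairs (move of A, move of B) that the strategy under attack admits at
  position \<open>p\<close>, and \<open>lo n p\<close> is a lower bound for the limits of the plays continuing \<open>p\<close>.
  For a strategy of A the bound has to be A's next move rather than A's last one, since at a given
  position B has no influence on that next move and the two replies would share it.
\<close>

lemma uncountable_closed_set_of_limits:
  fixes M :: "nat \<Rightarrow> (real \<times> real) list \<Rightarrow> (real \<times> real) set"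
  assumes "a0 < b0"
    and M: "\<And>n p m. p \<in> cantor_positions a0 b0 n \<Longrightarrow> m \<in> M n p \<Longrightarrow>
              fst (p ! n) < fst m \<and> fst m < snd m \<and> snd m < snd (p ! n) \<and> lo n p \<le> fst m"
    and lo: "\<And>n p. p \<in> cantor_positions a0 b0 n \<Longrightarrow> fst (p ! n) \<le> lo n p \<and> lo n p \<le> snd (p ! n)"
    and split: "\<And>n p e. p \<in> cantor_positions a0 b0 n \<Longrightarrow> 0 < e \<Longrightarrow>
              \<exists>m\<^sub>0\<in>M n p. \<exists>m\<^sub>1\<in>M n p. snd m\<^sub>0 - fst m\<^sub>0 < e \<and> snd m\<^sub>1 - fst m\<^sub>1 < e \<and>
                snd m\<^sub>0 < lo (Suc n) (p @ [m\<^sub>1])"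
  obtains K where "closed K" "uncountable K" "K \<subseteq> {a0..b0}"
    "\<And>x. x \<in> K \<Longrightarrow> \<exists>a b. cantor_play a0 b0 a b \<and> a \<longlonglongrightarrow> x \<and>
        (\<forall>n. (a (Suc n), b (Suc n)) \<in> M n (cantor_history a b n))"
proof -
  \<comment> \<open>\<open>False\<close> labels the left child and \<open>True\<close> the right
    one: the last condition puts the right end of the left child's interval below the left end of
    the right child's.\<close>
  define good where "good n p q \<longleftrightarrow>
      (\<forall>c. q c \<in> M n p \<and> snd (q c) - fst (q c) < 1 / real (Suc n)) \<and>
      snd (q False) < lo (Suc n) (p @ [q True])" for n p and q :: "bool \<Rightarrow> real \<times> real"
  have "\<exists>q. good n p q" if "p \<in> cantor_positions a0 b0 n" for n p
  proof -
    obtain m\<^sub>0 m\<^sub>1 where "m\<^sub>0 \<in> M n p" "m\<^sub>1 \<in> M n p" "snd m\<^sub>0 - fst m\<^sub>0 < 1 / real (Suc n)"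
      "snd m\<^sub>1 - fst m\<^sub>1 < 1 / real (Suc n)" "snd m\<^sub>0 < lo (Suc n) (p @ [m\<^sub>1])"
      using split[OF \<open>p \<in> cantor_positions a0 b0 n\<close>, of "1 / real (Suc n)"]
        of_nat_0_less_iff zero_less_Suc zero_less_divide_1_iff by blast
    then have "good n p (\<lambda>c. if c then m\<^sub>1 else m\<^sub>0)" by (simp add: good_def)
    then show ?thesis by blast
  qed
  moreover define q where "q n p = (SOME q. good n p q)" for n p
  ultimately have "good n p (q n p)" if "p \<in> cantor_positions a0 b0 n" for n p
    using that by (simp add: someI_ex)
  then have q: "\<And>n p c. p \<in> cantor_positions a0 b0 n \<Longrightarrow> q n p c \<in> M n p"
      "\<And>n p c. p \<in> cantor_positions a0 b0 n \<Longrightarrow> snd (q n p c) - fst (q n p c) < 1 / real (Suc n)"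
      "\<And>n p. p \<in> cantor_positions a0 b0 n \<Longrightarrow> snd (q n p False) < lo (Suc n) (p @ [q n p True])"
    unfolding good_def by blast+
  \<comment> \<open>A list of choices becomes the position it leads to; its length is the number of
    turns played and so the index for \<open>q\<close>.\<close>
  define node where "node = rec_list [(a0, b0)] (\<lambda>c s p. p @ [q (length s) p c])"
  have node_Nil: "node [] = [(a0, b0)]"
    and node_Cons: "node (c # s) = node s @ [q (length s) (node s) c]" for c s
    by (simp_all add: node_def)
  have node: "node s \<in> cantor_positions a0 b0 (length s)" for s
  proof (induction s)
    case Nil
    show ?case using cantor_positions_0[OF \<open>a0 < b0\<close>] by (simp add: node_Nil)
  next
    case (Cons c s)
    show ?case
      using M[OF Cons q(1)[OF Cons, of c]] by (simp add: node_Cons cantor_positions_append[OF Cons])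
  qed
  have last: "node (c # s) ! length (c # s) = q (length s) (node s) c" for c s
    using cantor_positions_length[OF node[of s]] by (simp add: node_Cons nth_append)
  define I where "I s = {lo (length s) (node s)..snd (node s ! length s)}" for s
  \<comment> \<open>Left ends do not decrease: \<open>lo\<close> at the parent is at most the chosen
    move of A, which is at most \<open>lo\<close> at the child.\<close>
  have step: "lo (length s) (node s) \<le> lo (length (c # s)) (node (c # s))"
    "snd (node (c # s) ! length (c # s)) \<le> snd (node s ! length s)" for c s
    using M[OF node q(1)[OF node[of s], of c]] lo[OF node, of "c # s"] unfolding last by linarith+
  obtain K where K: "closed K" "uncountable K" "\<And>x. x \<in> K \<Longrightarrow> \<exists>c. \<forall>n. x \<in> I (branch c n)"
  proof (rule cantor_scheme[of I])
    show "compact (I s)" for s by (simp add: I_def)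
    show "I s \<noteq> {}" for s using lo[OF node, of s] by (simp add: I_def)
    show "I (c # s) \<subseteq> I s" for c s
      unfolding I_def using step[where c = c and s = s] by (simp only: atLeastatMost_subset_iff) blast
    show "I (True # s) \<inter> I (False # s) = {}" for s
    proof -
      have "snd (node (False # s) ! length (False # s)) < lo (length (True # s)) (node (True # s))"
        unfolding last using q(3)[OF node[of s]] by (simp add: node_Cons)
      then show ?thesis unfolding I_def by fastforce
    qed
  qed (rule that)
  show thesis
  proof (rule that[OF K(1,2)])
    show "K \<subseteq> {a0..b0}"
    proof
      fix x assume "x \<in> K"
      then obtain c where "x \<in> I (branch c 0)" using K(3) by blast
      then show "x \<in> {a0..b0}" using lo[OF node, of "[]"] by (simp add: I_def node_Nil)
    qed
    fix x assume "x \<in> K"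
    then obtain c where c: "\<And>n. x \<in> I (branch c n)" using K(3) by blast
    define p where "p n = node (branch c n)" for n
    define a where "a n = fst (p n ! n)" for n
    define b where "b n = snd (p n ! n)" for n
    have p: "p n \<in> cantor_positions a0 b0 n" for n
      using node[of "branch c n"] by (simp add: p_def)
    have move: "(a (Suc n), b (Suc n)) = q n (p n) (c n)" for n
      using last[of "c n" "branch c n"] by (simp add: a_def b_def p_def)
    have p_Suc: "p (Suc n) = p n @ [(a (Suc n), b (Suc n))]" for n
      unfolding move by (simp add: p_def node_Cons)
    \<comment> \<open>Histories of the play are positions of the tree, which turns membership in
      \<open>M n (p n)\<close> into consistency of the play.\<close>
    have history: "cantor_history a b n = p n" for n
    proof (induction n)
      case 0
      show ?case by (simp add: cantor_history_def a_def b_def p_def node_Nil)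
    next
      case (Suc n)
      then show ?case by (simp only: cantor_history_Suc p_Suc)
    qed
    have in_M: "(a (Suc n), b (Suc n)) \<in> M n (p n)" for n
      unfolding move by (rule q(1)[OF p])
    have "a 0 = a0" "b 0 = b0" by (simp_all add: a_def b_def p_def node_Nil)
    moreover have "a n < a (Suc n) \<and> a (Suc n) < b (Suc n) \<and> b (Suc n) < b n" for n
      using M[OF p in_M, of n] by (simp add: a_def[of n] b_def[of n])
    ultimately have "cantor_play a0 b0 a b" by (simp add: cantor_play_def)
    moreover have "a \<longlonglongrightarrow> x"
    proof (rule cantor_play_convergent)
      have "x \<in> {lo n (p n)..b n}" for n
        using c[of n] by (simp add: I_def b_def p_def)
      then show "a n \<le> x" "x \<le> b n" for n
        using lo[OF p, of n] by (auto simp: a_def intro: order_trans)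
      show "b (Suc n) - a (Suc n) < 1 / real (Suc n)" for n
        using q(2)[OF p[of n], of "c n"] unfolding move[symmetric] by simp
    qed
    ultimately show "\<exists>a b. cantor_play a0 b0 a b \<and> a \<longlonglongrightarrow> x \<and>
        (\<forall>n. (a (Suc n), b (Suc n)) \<in> M n (cantor_history a b n))"
      using in_M unfolding history[symmetric] by blast
  qed
qed

section \<open>Limit sets of strategies\<close>

text \<open>B moves only the right end, so two replies are separated through A's answer: a reply
  below A's answer to another reply leaves only limits below those of the other. Hence
  \<open>f\<close> itself serves as \<open>lo\<close>.\<close>

lemma limit_set_A_contains_uncountable_closed:
  assumes "a0 < b0" and f: "strategy_A a0 b0 f"
  obtains K where "closed K" "uncountable K" "K \<subseteq> {a0..b0}" "K \<subseteq> limit_set_A a0 b0 f"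
proof -
  have f: "fst (p ! n) < f n p" "f n p < snd (p ! n)" if "p \<in> cantor_positions a0 b0 n" for n p
    using f that by (auto simp: strategy_A_def)
  let ?M = "\<lambda>n p. {f n p} \<times> {f n p<..<snd (p ! n)}"
  obtain K where K: "closed K" "uncountable K" "K \<subseteq> {a0..b0}"
    "\<And>x. x \<in> K \<Longrightarrow> \<exists>a b. cantor_play a0 b0 a b \<and> a \<longlonglongrightarrow> x \<and>
        (\<forall>n. (a (Suc n), b (Suc n)) \<in> ?M n (cantor_history a b n))"
  proof (rule uncountable_closed_set_of_limits[OF \<open>a0 < b0\<close>, of ?M f])
    show "fst (p ! n) \<le> f n p \<and> f n p \<le> snd (p ! n)" if "p \<in> cantor_positions a0 b0 n" for n p
      using f[OF that] by simp
    show "fst (p ! n) < fst m \<and> fst m < snd m \<and> snd m < snd (p ! n) \<and> f n p \<le> fst m"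
      if "p \<in> cantor_positions a0 b0 n" "m \<in> ?M n p" for n p m
      using f[OF that(1)] that(2) by auto
    fix n p and e :: real
    assume p: "p \<in> cantor_positions a0 b0 n" and "0 < e"
    let ?x = "f n p"
    \<comment> \<open>This is the larger of the two replies; keeping it within \<open>e\<close> of
      A's move makes both remaining intervals short.\<close>
    obtain y\<^sub>1 where y1: "?x < y\<^sub>1" "y\<^sub>1 < min (snd (p ! n)) (?x + e)"
      using dense[of ?x "min (snd (p ! n)) (?x + e)"] f(2)[OF p] \<open>0 < e\<close> by auto
    have p': "p @ [(?x, y\<^sub>1)] \<in> cantor_positions a0 b0 (Suc n)"
      using y1 f[OF p] by (intro cantor_positions_append[OF p]) auto
    \<comment> \<open>\<open>y\<^sub>0\<close> is placed below A's answer to \<open>y\<^sub>1\<close>.\<close>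
    obtain y\<^sub>0 where y0: "?x < y\<^sub>0" "y\<^sub>0 < f (Suc n) (p @ [(?x, y\<^sub>1)])"
      using dense f(1)[OF p'] cantor_positions_length[OF p] by (auto simp: nth_append)
    \<comment> \<open>This gives \<open>y\<^sub>0 < y\<^sub>1\<close>, so \<open>y\<^sub>0\<close>
      inherits both legality and shortness from \<open>y\<^sub>1\<close>.\<close>
    moreover have "f (Suc n) (p @ [(?x, y\<^sub>1)]) < y\<^sub>1"
      using f(2)[OF p'] cantor_positions_length[OF p] by (simp add: nth_append)
    ultimately show "\<exists>m\<^sub>0\<in>?M n p. \<exists>m\<^sub>1\<in>?M n p. snd m\<^sub>0 - fst m\<^sub>0 < e \<and> snd m\<^sub>1 - fst m\<^sub>1 < e \<and>
        snd m\<^sub>0 < f (Suc n) (p @ [m\<^sub>1])"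
      using y1 by (intro bexI[of _ "(?x, y\<^sub>0)"] bexI[of _ "(?x, y\<^sub>1)"]) auto
  qed (rule that)
  have "x \<in> limit_set_A a0 b0 f" if "x \<in> K" for x
  proof -
    obtain a b where "cantor_play a0 b0 a b" "a \<longlonglongrightarrow> x"
      "\<forall>n. (a (Suc n), b (Suc n)) \<in> ?M n (cantor_history a b n)"
      using K(4)[OF \<open>x \<in> K\<close>] by blast
    moreover from this(3) have "consistent_A f a b"
      unfolding consistent_A_def by blast
    ultimately show ?thesis unfolding limit_set_A_def by blast
  qed
  then show thesis by (intro that[OF K(1-3)] subsetI)
qed

text \<open>A chooses the left end freely, so A's last move already serves as \<open>lo\<close>: a
  second move beyond B's reply to the first separates the two choices.\<close>

lemma limit_set_B_contains_uncountable_closed: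
  assumes "a0 < b0" and g: "strategy_B a0 b0 g"
  obtains K where "closed K" "uncountable K" "K \<subseteq> {a0..b0}" "K \<subseteq> limit_set_B a0 b0 g"
proof -
  have g: "x < g n p x" "g n p x < snd (p ! n)"
    if "p \<in> cantor_positions a0 b0 n" "fst (p ! n) < x" "x < snd (p ! n)" for n p x
    using g that by (auto simp: strategy_B_def)
  let ?M = "\<lambda>n p. (\<lambda>x. (x, g n p x)) ` {fst (p ! n)<..<snd (p ! n)}"
  obtain K where K: "closed K" "uncountable K" "K \<subseteq> {a0..b0}"
    "\<And>x. x \<in> K \<Longrightarrow> \<exists>a b. cantor_play a0 b0 a b \<and> a \<longlonglongrightarrow> x \<and>
        (\<forall>n. (a (Suc n), b (Suc n)) \<in> ?M n (cantor_history a b n))"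
  proof (rule uncountable_closed_set_of_limits[OF \<open>a0 < b0\<close>, of ?M "\<lambda>n p. fst (p ! n)"])
    show "fst (p ! n) \<le> fst (p ! n) \<and> fst (p ! n) \<le> snd (p ! n)"
      if "p \<in> cantor_positions a0 b0 n" for n p
      using cantor_positions_less[OF that] by simp
    show "fst (p ! n) < fst m \<and> fst m < snd m \<and> snd m < snd (p ! n) \<and> fst (p ! n) \<le> fst m"
      if "p \<in> cantor_positions a0 b0 n" "m \<in> ?M n p" for n p m
      using g[OF that(1)] that(2) by auto
    fix n p and e :: real
    assume p: "p \<in> cantor_positions a0 b0 n" and "0 < e"
    let ?a = "fst (p ! n)" and ?b = "snd (p ! n)"
    \<comment> \<open>Starting within \<open>e\<close> of the right end makes the interval short
      whatever B replies; this covers \<open>x\<^sub>1\<close> too, which lies further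
      right.\<close>
    obtain x\<^sub>0 where x0: "max ?a (?b - e) < x\<^sub>0" "x\<^sub>0 < ?b"
      using dense[of "max ?a (?b - e)" ?b] cantor_positions_less[OF p] \<open>0 < e\<close> by auto
    then have y0: "x\<^sub>0 < g n p x\<^sub>0" "g n p x\<^sub>0 < ?b" using g[OF p] by auto
    obtain x\<^sub>1 where x1: "g n p x\<^sub>0 < x\<^sub>1" "x\<^sub>1 < ?b" using dense y0(2) by blast
    then have y1: "g n p x\<^sub>1 < ?b" using g(2)[OF p, of x\<^sub>1] x0 y0 by simp
    show "\<exists>m\<^sub>0\<in>?M n p. \<exists>m\<^sub>1\<in>?M n p. snd m\<^sub>0 - fst m\<^sub>0 < e \<and> snd m\<^sub>1 - fst m\<^sub>1 < e \<and>
        snd m\<^sub>0 < fst ((p @ [m\<^sub>1]) ! Suc n)"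
      using x0 y0 x1 y1 cantor_positions_length[OF p]
      by (intro bexI[of _ "(x\<^sub>0, g n p x\<^sub>0)"] bexI[of _ "(x\<^sub>1, g n p x\<^sub>1)"]) (auto simp: nth_append)
  qed (rule that)
  have "x \<in> limit_set_B a0 b0 g" if "x \<in> K" for x
  proof -
    obtain a b where "cantor_play a0 b0 a b" "a \<longlonglongrightarrow> x"
      "\<forall>n. (a (Suc n), b (Suc n)) \<in> ?M n (cantor_history a b n)"
      using K(4)[OF \<open>x \<in> K\<close>] by blast
    moreover from this(3) have "consistent_B g a b"
      unfolding consistent_B_def by blast
    ultimately show ?thesis unfolding limit_set_B_def by blast
  qed
  then show thesis by (intro that[OF K(1-3)] subsetI)
qed

theorem corollary6:
  fixes a0 b0 :: real and S :: "real set"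
  assumes "a0 < b0"
    and "S \<subseteq> {a0..b0}"
    and "bernstein_set_in {a0..b0} S"
  shows "(\<nexists>f. winning_strategy_A a0 b0 S f) \<and> (\<nexists>g. winning_strategy_B a0 b0 S g)"
proof -
  have bernstein: "\<not> K \<subseteq> S \<and> \<not> K \<subseteq> {a0..b0} - S"
    if "closed K" "uncountable K" "K \<subseteq> {a0..b0}" for K
    using assms(3) that by (auto simp: bernstein_set_in_def intro: closed_subset)
  \<comment> \<open>A win for A would place an uncountable closed set inside \<open>S\<close>, a win
    for B inside its complement; \<open>bernstein\<close> excludes both.\<close>
  have "\<not> winning_strategy_A a0 b0 S f" for f
    using limit_set_A_contains_uncountable_closed[OF assms(1), of f] bernstein
    unfolding winning_strategy_A_def by (metis subset_trans)
  moreover have "\<not> winning_strategy_B a0 b0 S g" for g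
    using limit_set_B_contains_uncountable_closed[OF assms(1), of g] bernstein
    unfolding winning_strategy_B_def by (metis subset_trans)
  ultimately show ?thesis by blast
qed

end
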